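(* Let $F$ be an arbitrary field, let $R$ be an associative $F$-algebra with non-trivial center, and let $V\subseteq R$ be a vector subspace which generates $R$ as an algebra. Let $c(X)=c(x_1,\ldots,x_n)\in F\langle X\rangle$ be a non-trivial central polynomial for $R$ which is not multilinear. Then one may also produce from $c$ a non-trivial central polynomial for the pair $(R,V)$, as follows. There exist $r_1,\ldots,r_n\in R$ such that $c(r_1,\ldots,r_n)\neq 0$. Each $r_p$ can be expressed as a finite sum \[ r_p=\sum_i\alpha_{pi}\,v_{i_1}^{(p)}\cdots v_{i_{h_i}}^{(p)},\qquad v_{i_j}^{(p)}\in V,\ \alpha_{pi}\in F,\quad p=1,\ldots,n, \] and the polynomial \[ c'(Y)=c\Big(\sum_i\alpha_{1i}\,y_{1i_1}\cdots y_{1i_{h_i}},\ldots,\sum_i\alpha_{ni}\,y_{ni_1}\cdots y_{ni_{h_i}}\Big)\in F\langle Y\rangle, \] obtained by replacing each factor $v_{i_j}^{(p)}$ by the variable $y_{pi_j}$, does not vanish on $V$ and hence is a non-trivial central polynomial for the pair $(R,V)$.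
   Context: $F\langle X\rangle=F\langle x_1,x_2,\ldots\rangle$ and $F\langle Y\rangle$ denote free associative algebras over $F$, where $Y$ is another set of free variables $y_{pi_j}$, one for each factor $v_{i_j}^{(p)}$ in the expressions of the $r_p$. In each sum $i$ indexes the summands and $h_i$ is the number of factors in the $i$-th product (it may depend on $p$). A polynomial $f(x_1,\ldots,x_n)$ is an identity for the pair $(R,V)$ if $f(v_1,\ldots,v_n)=0$ for all $v_1,\ldots,v_n\in V$. A polynomial $c(x_1,\ldots,x_n)$ is a (non-trivial, or essential) central polynomial for the pair $(R,V)$ if $c(v_1,\ldots,v_n)$ belongs to the center of $R$ for all $v_1,\ldots,v_n\in V$ and $c$ is not an identity for $(R,V)$. A non-trivial central polynomial of the algebra $R$ is a non-trivial central polynomial for the pair $(R,R)$. A polynomial is multilinear if it is linear in each of its variables. *)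

theory Defs
  imports Complex_Main "HOL-Library.Poly_Mapping"
begin

section \<open>The free associative algebra\<close>

text \<open>
  Words form a monoid under concatenation, so the monoid algebra \<open>'x list \<Rightarrow>\<^sub>0 'f\<close> over a
  field is the free unital associative algebra on the variables \<open>'x\<close>; its ring structure is the
  convolution product of \<^theory>\<open>HOL-Library.Poly_Mapping\<close>.
\<close>

instantiation list :: (type) monoid_add
begin

definition zero_list :: "'a list" where "zero_list = []"

definition plus_list :: "'a list \<Rightarrow> 'a list \<Rightarrow> 'a list" where "plus_list = (@)"

instance by standard (simp_all add: zero_list_def plus_list_def)

end

type_synonym ('x, 'f) ncpoly = "'x list \<Rightarrow>\<^sub>0 'f"

definition var :: "'x \<Rightarrow> ('x, 'f::field) ncpoly" where
  "var x = Poly_Mapping.single [x] 1"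

definition pscale :: "'f::field \<Rightarrow> ('x, 'f) ncpoly \<Rightarrow> ('x, 'f) ncpoly" where
  "pscale a f = Poly_Mapping.map ((*) a) f"

definition vars :: "('x, 'f::field) ncpoly \<Rightarrow> 'x set" where
  "vars f = (\<Union>w\<in>Poly_Mapping.keys f. set w)"

text \<open>\<open>subst \<sigma> f\<close> is \<open>f\<close> with every variable \<open>x\<close> replaced by the polynomial \<open>\<sigma> x\<close>.\<close>

definition subst :: "('x \<Rightarrow> ('y, 'f) ncpoly) \<Rightarrow> ('x, 'f::field) ncpoly \<Rightarrow> ('y, 'f) ncpoly" where
  "subst \<sigma> f = (\<Sum>w\<in>Poly_Mapping.keys f. pscale (Poly_Mapping.lookup f w) (prod_list (map \<sigma> w)))"

text \<open>\<open>X\<close> is the set of variables of which \<open>f\<close> is considered to be a function.\<close>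

definition multilinear :: "'x set \<Rightarrow> ('x, 'f::field) ncpoly \<Rightarrow> bool" where
  "multilinear X f \<longleftrightarrow> (\<forall>x\<in>X. \<forall>w\<in>Poly_Mapping.keys f. count_list w x = 1)"


section \<open>Associative algebras\<close>

text \<open>
  The class \<^class>\<open>ring\<close> does not demand an identity element. The parameter \<open>u\<close> selects the
  category: for \<open>u = Some e\<close> we work with unital algebras, \<open>e\<close> being the identity (constant
  terms, empty products and subalgebras refer to \<open>e\<close>); for \<open>u = None\<close> we work with algebras
  that need not be unital, so that polynomials have no constant term and products have at least
  one factor.
\<close>

locale assoc_algebra = vector_space scale
  for scale :: "'f::field \<Rightarrow> 'a::ring \<Rightarrow> 'a" +
  fixes u :: "'a option"
  assumes scale_mult_left: "scale a x * y = scale a (x * y)"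
    and scale_mult_right: "x * scale a y = scale a (x * y)"
    and unit_left: "u = Some e \<Longrightarrow> e * x = x"
    and unit_right: "u = Some e \<Longrightarrow> x * e = x"

definition center :: "'a::ring set" where
  "center = {z. \<forall>x. z * x = x * z}"

definition subalgebra :: "('f::field \<Rightarrow> 'a::ring \<Rightarrow> 'a) \<Rightarrow> 'a option \<Rightarrow> 'a set \<Rightarrow> bool" where
  "subalgebra scale u S \<longleftrightarrow>
     module.subspace scale S \<and> (\<forall>x\<in>S. \<forall>y\<in>S. x * y \<in> S) \<and> (\<forall>e. u = Some e \<longrightarrow> e \<in> S)"

text \<open>The value \<open>0\<close> for the empty word and \<open>u = None\<close> is a dummy: see \<open>admissible\<close> and
  \<open>is_expression\<close> below.\<close>

fun word_prod :: "'a option \<Rightarrow> 'a::ring list \<Rightarrow> 'a" where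
  "word_prod u [] = (case u of None \<Rightarrow> 0 | Some e \<Rightarrow> e)"
| "word_prod u [x] = x"
| "word_prod u (x # y # ys) = x * word_prod u (y # ys)"

definition eval ::
  "('f::field \<Rightarrow> 'a::ring \<Rightarrow> 'a) \<Rightarrow> 'a option \<Rightarrow> ('x \<Rightarrow> 'a) \<Rightarrow> ('x, 'f) ncpoly \<Rightarrow> 'a" where
  "eval scale u r f =
     (\<Sum>w\<in>Poly_Mapping.keys f. scale (Poly_Mapping.lookup f w) (word_prod u (map r w)))"

definition admissible :: "'a option \<Rightarrow> ('x, 'f::field) ncpoly \<Rightarrow> bool" where
  "admissible u f \<longleftrightarrow> (u = None \<longrightarrow> Poly_Mapping.lookup f [] = 0)"


section \<open>Identities and central polynomials for a pair \<open>(R, V)\<close>\<close>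

definition pair_identity ::
  "('f::field \<Rightarrow> 'a::ring \<Rightarrow> 'a) \<Rightarrow> 'a option \<Rightarrow> 'a set \<Rightarrow> ('x, 'f) ncpoly \<Rightarrow> bool" where
  "pair_identity scale u V f \<longleftrightarrow>
     admissible u f \<and> (\<forall>r. (\<forall>x. r x \<in> V) \<longrightarrow> eval scale u r f = 0)"

definition central_polynomial ::
  "('f::field \<Rightarrow> 'a::ring \<Rightarrow> 'a) \<Rightarrow> 'a option \<Rightarrow> 'a set \<Rightarrow> ('x, 'f) ncpoly \<Rightarrow> bool" where
  "central_polynomial scale u V f \<longleftrightarrow>
     admissible u f \<and> (\<forall>r. (\<forall>x. r x \<in> V) \<longrightarrow> eval scale u r f \<in> center) \<and>
     \<not> pair_identity scale u V f"


section \<open>Expressing elements through generators\<close>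

text \<open>
  \<open>x = \<Sum>i=1..m. \<alpha>\<^sub>i v\<^sub>i\<^sub>1 \<cdots> v\<^sub>i\<^sub>h\<close> with \<open>h = h i\<close> factors \<open>v i j \<in> V\<close> in the \<open>i\<close>-th summand.
\<close>

definition is_expression ::
  "('f::field \<Rightarrow> 'a::ring \<Rightarrow> 'a) \<Rightarrow> 'a option \<Rightarrow> 'a set \<Rightarrow> 'a \<Rightarrow>
   nat \<Rightarrow> (nat \<Rightarrow> 'f) \<Rightarrow> (nat \<Rightarrow> nat) \<Rightarrow> (nat \<Rightarrow> nat \<Rightarrow> 'a) \<Rightarrow> bool" where
  "is_expression scale u V x m \<alpha> h v \<longleftrightarrow>
     (\<forall>i\<in>{1..m}. (u = None \<longrightarrow> h i \<ge> 1) \<and> (\<forall>j\<in>{1..h i}. v i j \<in> V)) \<and>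
     x = (\<Sum>i\<in>{1..m}. scale (\<alpha> i) (word_prod u (map (v i) [1..<Suc (h i)])))"

definition expression_poly ::
  "nat \<Rightarrow> (nat \<Rightarrow> 'f) \<Rightarrow> (nat \<Rightarrow> nat) \<Rightarrow> (nat \<Rightarrow> nat \<Rightarrow> 'y) \<Rightarrow> ('y, 'f::field) ncpoly" where
  "expression_poly m \<alpha> h y =
     (\<Sum>i\<in>{1..m}. pscale (\<alpha> i) (prod_list (map (\<lambda>j. var (y i j)) [1..<Suc (h i)])))"

text \<open>
  The polynomial \<open>c'\<close>. The variable \<open>y\<^sub>p\<^sub>i\<^sub>j\<close> replacing the \<open>j\<close>-th factor of the \<open>i\<close>-th summand of
  \<open>r\<^sub>p\<close> is named by the triple \<open>(p, i, j)\<close>.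
\<close>

definition derived_poly ::
  "(nat, 'f::field) ncpoly \<Rightarrow> (nat \<Rightarrow> nat) \<Rightarrow> (nat \<Rightarrow> nat \<Rightarrow> 'f) \<Rightarrow> (nat \<Rightarrow> nat \<Rightarrow> nat) \<Rightarrow>
   (nat \<times> nat \<times> nat, 'f) ncpoly" where
  "derived_poly c m \<alpha> h =
     subst (\<lambda>p. expression_poly (m p) (\<alpha> p) (h p) (\<lambda>i j. (p, i, j))) c"

end

theory Submission
  imports Defs
begin

text \<open>
  Evaluation is linear, and it is multiplicative on products in which every factor is admissible;
  hence evaluating \<open>subst \<sigma> c\<close> amounts to evaluating \<open>c\<close> at the values of the \<open>\<sigma> p\<close>. So every value
  of \<open>c'\<close> on \<open>V\<close> is a value of \<open>c\<close> on \<open>R\<close>, hence central, and giving the variables \<open>y\<^sub>p\<^sub>i\<^sub>j\<close> the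
  values \<open>v\<^sub>p\<^sub>i\<^sub>j\<close> recovers \<open>c(r\<^sub>1, \<dots>, r\<^sub>n) \<noteq> 0\<close>.
\<close>

section \<open>Coefficients, supports and admissibility\<close>

lemma lookup_pscale: "Poly_Mapping.lookup (pscale a f) w = a * Poly_Mapping.lookup f w"
  unfolding pscale_def by (rule map.rep_eq[THEN fun_cong, THEN trans]) (simp add: when_def)

lemma sum_monomials:
  "(\<Sum>w\<in>Poly_Mapping.keys f. Poly_Mapping.single w (Poly_Mapping.lookup f w)) = f"
  by (rule poly_mapping_eqI) (auto simp: lookup_sum lookup_single when_def in_keys_iff)

lemma keys_pscale_subset: "Poly_Mapping.keys (pscale a f) \<subseteq> Poly_Mapping.keys f"
  by (auto simp: in_keys_iff lookup_pscale)

lemma admissible_iff: "admissible u f \<longleftrightarrow> (u = None \<longrightarrow> [] \<notin> Poly_Mapping.keys f)"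
  by (simp add: admissible_def in_keys_iff)

lemma admissible_pscale: "admissible u f \<Longrightarrow> admissible u (pscale a f)"
  by (simp add: admissible_def lookup_pscale)

lemma admissible_sum: "(\<And>i. i \<in> I \<Longrightarrow> admissible u (f i)) \<Longrightarrow> admissible u (sum f I)"
  by (simp add: admissible_def lookup_sum)

lemma admissible_var: "admissible u (var x)"
  by (simp add: admissible_def var_def lookup_single)

text \<open>Every word of \<open>f * g\<close> is a concatenation whose left part is a word of
  \<open>f\<close>; if that part is non-empty, so is the whole.\<close>

lemma admissible_mult_left: "admissible u f \<Longrightarrow> admissible u (f * g)"
  using keys_mult[of f g] by (fastforce simp: admissible_iff plus_list_def)

lemma admissible_prod_list:
  assumes "\<And>x. x \<in> set w \<Longrightarrow> admissible u (\<sigma> x)" "u = None \<Longrightarrow> w \<noteq> []"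
  shows "admissible u (prod_list (map \<sigma> w))"
proof (cases w)
  case Nil
  with assms(2) show ?thesis by (auto simp: admissible_def)
next
  case (Cons a w')
  with assms(1) show ?thesis by (simp add: admissible_mult_left)
qed

section \<open>Word products and evaluation as a homomorphism\<close>

context assoc_algebra
begin

text \<open>The recursion of \<open>word_prod\<close> stops at one letter, which keeps the dummy
  value of the empty word out of products. With a unit, the last letter splits off too, since
  \<open>x * e = x\<close>.\<close>

lemma word_prod_Cons:
  "u \<noteq> None \<or> xs \<noteq> [] \<Longrightarrow> word_prod u (x # xs) = x * word_prod u xs"
  by (cases xs) (auto simp: unit_right)

lemma word_prod_append:
  assumes "u \<noteq> None \<or> (xs \<noteq> [] \<and> ys \<noteq> [])"
  shows "word_prod u (xs @ ys) = word_prod u xs * word_prod u ys"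
  using assms
proof (induction xs)
  case Nil
  then show ?case by (auto simp: unit_left)
next
  case (Cons x xs)
  show ?case
  proof (cases "u \<noteq> None \<or> xs \<noteq> []")
    case True
    then show ?thesis
      using Cons by (auto simp: word_prod_Cons mult.assoc)
  next
    case False
    \<comment> \<open>Here \<open>u = None\<close> and \<open>xs = []\<close>, so the premise forces
      \<open>ys\<close> to be non-empty.\<close>
    then show ?thesis using Cons.prems word_prod_Cons[of ys x] by simp
  qed
qed

text \<open>Cancellation or a zero scalar can shrink the support; a larger index set, on which the
  extra coefficients vanish, allows termwise comparison.\<close>

lemma eval_superset:
  assumes "finite A" "Poly_Mapping.keys f \<subseteq> A"
  shows "eval scale u r f = (\<Sum>w\<in>A. scale (Poly_Mapping.lookup f w) (word_prod u (map r w)))"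
  unfolding eval_def using assms by (intro sum.mono_neutral_left) (auto simp: in_keys_iff)

lemma eval_zero: "eval scale u r 0 = 0"
  by (simp add: eval_def)

lemma eval_add: "eval scale u r (f + g) = eval scale u r f + eval scale u r g"
proof -
  let ?A = "Poly_Mapping.keys f \<union> Poly_Mapping.keys g"
  have "Poly_Mapping.keys (f + g) \<subseteq> ?A" by (rule Poly_Mapping.keys_add)
  then show ?thesis
    by (simp add: eval_superset[of ?A] lookup_add scale_left_distrib sum.distrib)
qed

lemma eval_sum: "eval scale u r (sum f I) = (\<Sum>i\<in>I. eval scale u r (f i))"
  by (induction I rule: infinite_finite_induct) (simp_all add: eval_zero eval_add)

lemma eval_pscale: "eval scale u r (pscale a f) = scale a (eval scale u r f)"
  using eval_superset[OF finite_keys keys_pscale_subset, of r a f]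
  by (simp add: lookup_pscale eval_def scale_sum_right)

lemma eval_single: "eval scale u r (Poly_Mapping.single w a) = scale a (word_prod u (map r w))"
  by (simp add: eval_superset[of "{w}"])

lemma eval_var: "eval scale u r (var x) = r x"
  by (simp add: var_def eval_single)

text \<open>Expanding both factors into monomials reduces this to concatenation of words. For
  \<open>u = None\<close> admissibility makes all these words non-empty, so
  \<open>word_prod_append\<close> applies.\<close>

lemma eval_mult:
  assumes "admissible u f" "admissible u g"
  shows "eval scale u r (f * g) = eval scale u r f * eval scale u r g"
proof -
  let ?l = Poly_Mapping.lookup and ?k = Poly_Mapping.keys
  have "f * g = (\<Sum>v\<in>?k f. Poly_Mapping.single v (?l f v)) *
      (\<Sum>w\<in>?k g. Poly_Mapping.single w (?l g w))"
    by (simp add: sum_monomials)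
  also have "\<dots> = (\<Sum>v\<in>?k f. \<Sum>w\<in>?k g. Poly_Mapping.single (v @ w) (?l f v * ?l g w))"
    by (simp add: sum_product mult_single plus_list_def)
  finally have "eval scale u r (f * g) =
      (\<Sum>v\<in>?k f. \<Sum>w\<in>?k g. scale (?l f v * ?l g w) (word_prod u (map r v @ map r w)))"
    by (simp add: eval_sum eval_single)
  also have "\<dots> = (\<Sum>v\<in>?k f. \<Sum>w\<in>?k g.
      scale (?l f v) (word_prod u (map r v)) * scale (?l g w) (word_prod u (map r w)))"
  proof (intro sum.cong refl)
    fix v w
    assume "v \<in> ?k f" "w \<in> ?k g"
    then have "u \<noteq> None \<or> (map r v \<noteq> [] \<and> map r w \<noteq> [])"
      using assms by (auto simp: admissible_iff)
    then show "scale (?l f v * ?l g w) (word_prod u (map r v @ map r w)) =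
        scale (?l f v) (word_prod u (map r v)) * scale (?l g w) (word_prod u (map r w))"
      by (simp add: word_prod_append scale_mult_left scale_mult_right)
  qed
  finally show ?thesis by (simp add: eval_def sum_product)
qed

lemma eval_prod_list:
  assumes "\<And>x. x \<in> set w \<Longrightarrow> admissible u (\<sigma> x)" "u = None \<Longrightarrow> w \<noteq> []"
  shows "eval scale u r (prod_list (map \<sigma> w)) = word_prod u (map (\<lambda>x. eval scale u r (\<sigma> x)) w)"
  using assms
proof (induction w)
  case Nil
  \<comment> \<open>The unit of the convolution ring is concentrated at the zero of the word monoid,
    which is \<open>[]\<close>.\<close>
  have one: "(1 :: ('c, 'f) ncpoly) = Poly_Mapping.single [] 1"
    by (metis single_one zero_list_def)
  show ?case by (simp add: one eval_single)
next
  case (Cons x w)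
  show ?case
  proof (cases "u = None \<and> w = []")
    case True
    then show ?thesis by simp
  next
    case False
    then have "admissible u (prod_list (map \<sigma> w))"
      using Cons.prems by (intro admissible_prod_list) auto
    with False Cons show ?thesis
      by (subst list.map, subst word_prod_Cons) (auto simp: eval_mult)
  qed
qed

section \<open>Substitution of polynomials\<close>

lemma eval_subst:
  assumes "admissible u f" "\<And>x. x \<in> vars f \<Longrightarrow> admissible u (\<sigma> x)"
  shows "eval scale u r (subst \<sigma> f) = eval scale u (\<lambda>x. eval scale u r (\<sigma> x)) f"
proof -
  have "eval scale u r (prod_list (map \<sigma> w)) = word_prod u (map (\<lambda>x. eval scale u r (\<sigma> x)) w)"
    if "w \<in> Poly_Mapping.keys f" for w
    using that assms by (intro eval_prod_list) (auto simp: vars_def admissible_iff)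
  then show ?thesis
    unfolding subst_def eval_sum eval_pscale eval_def[of scale u "\<lambda>x. eval scale u r (\<sigma> x)"]
    by (intro sum.cong) auto
qed

lemma admissible_subst:
  assumes "admissible u f" "\<And>x. x \<in> vars f \<Longrightarrow> admissible u (\<sigma> x)"
  shows "admissible u (subst \<sigma> f)"
  unfolding subst_def using assms
  by (intro admissible_sum admissible_pscale admissible_prod_list)
     (auto simp: vars_def admissible_iff)

lemma eval_cong:
  assumes "\<And>x. x \<in> vars f \<Longrightarrow> r x = s x"
  shows "eval scale u r f = eval scale u s f"
  unfolding eval_def
proof (intro sum.cong refl arg_cong2[where f = scale] arg_cong[where f = "word_prod u"] map_cong)
  fix w x
  assume "w \<in> Poly_Mapping.keys f" "x \<in> set w"
  then show "r x = s x" using assms by (auto simp: vars_def)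
qed

section \<open>Values of expression polynomials\<close>

lemma admissible_expression_poly:
  assumes "is_expression scale u V x m \<alpha> h v"
  shows "admissible u (expression_poly m \<alpha> h y)"
  unfolding expression_poly_def using assms
  by (intro admissible_sum admissible_pscale admissible_prod_list)
     (auto simp: is_expression_def admissible_var)

lemma eval_expression_poly:
  assumes "is_expression scale u V x m \<alpha> h v"
    and "\<And>i j. i \<in> {1..m} \<Longrightarrow> j \<in> {1..h i} \<Longrightarrow> w (y i j) = v i j"
  shows "eval scale u w (expression_poly m \<alpha> h y) = x"
proof -
  have "eval scale u w (prod_list (map (\<lambda>j. var (y i j)) [1..<Suc (h i)])) =
      word_prod u (map (v i) [1..<Suc (h i)])" if i: "i \<in> {1..m}" for i
  proof -
    have "eval scale u w (prod_list (map (\<lambda>j. var (y i j)) [1..<Suc (h i)])) =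
        word_prod u (map (\<lambda>j. eval scale u w (var (y i j))) [1..<Suc (h i)])"
      \<comment> \<open>For \<open>u = None\<close> an expression has \<open>h i \<ge> 1\<close>, so
        the list of factors is non-empty.\<close>
      using assms(1) i by (intro eval_prod_list) (auto simp: admissible_var is_expression_def)
    also have "map (\<lambda>j. eval scale u w (var (y i j))) [1..<Suc (h i)] =
        map (v i) [1..<Suc (h i)]"
      using assms(2)[OF i] by (intro map_cong refl) (simp add: eval_var del: upt_Suc)
    finally show ?thesis .
  qed
  then show ?thesis
    using assms(1) by (simp add: expression_poly_def eval_sum eval_pscale is_expression_def)
qed

section \<open>Expressions exist: the generated subalgebra consists of combinations of words\<close>

lemma span_mult_closed:
  assumes "\<And>a b. a \<in> W \<Longrightarrow> b \<in> W \<Longrightarrow> a * b \<in> span W"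
    and "x \<in> span W" "y \<in> span W"
  shows "x * y \<in> span W"
proof -
  \<comment> \<open>Bilinearity in two inductions: first the right factor ranges over the span with
    a generator on the left, then the left factor does.\<close>
  have *: "a * y \<in> span W" if "a \<in> W" for a
    using assms(3)
    by (induction rule: span_induct_alt)
       (auto simp: distrib_left scale_mult_right intro: span_zero span_add span_scale assms(1)[OF that])
  show ?thesis
    using assms(2)
    by (induction rule: span_induct_alt)
       (auto simp: distrib_right scale_mult_left intro: span_zero span_add span_scale *)
qed

text \<open>The span of the words is itself a subalgebra containing \<open>V\<close>: one-letter
  words give \<open>V\<close>, concatenation gives products, and the empty word gives the identity
  when there is one.\<close>

lemma hull_subset_span_words:
  "subalgebra scale u hull V \<subseteq> span (word_prod u ` {ws. set ws \<subseteq> V \<and> (u = None \<longrightarrow> ws \<noteq> [])})"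
    (is "_ \<subseteq> span ?W")
proof (rule hull_minimal)
  show "V \<subseteq> span ?W"
  proof
    fix x
    assume "x \<in> V"
    then have "word_prod u [x] \<in> ?W" by (intro imageI) auto
    then show "x \<in> span ?W" by (simp add: span_base)
  qed
  have "a * b \<in> span ?W" if "a \<in> ?W" "b \<in> ?W" for a b
  proof -
    from that obtain xs ys where xs: "a = word_prod u xs" "set xs \<subseteq> V" "u = None \<longrightarrow> xs \<noteq> []"
      and ys: "b = word_prod u ys" "set ys \<subseteq> V" "u = None \<longrightarrow> ys \<noteq> []"
      by auto
    then have "a * b = word_prod u (xs @ ys)" by (subst word_prod_append) auto
    also have "\<dots> \<in> ?W" using xs ys by (intro imageI) auto
    finally show ?thesis by (rule span_base)
  qed
  moreover have "e \<in> span ?W" if "u = Some e" for e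
  proof -
    have "word_prod u [] \<in> ?W" using that by (intro imageI) auto
    then show ?thesis using that by (simp add: span_base)
  qed
  ultimately show "subalgebra scale u (span ?W)"
    by (auto simp: subalgebra_def subspace_span intro: span_mult_closed)
qed

text \<open>An element of the span is a combination of finitely many distinct word values; numbering
  these values from 1 and choosing a word for each yields the data of an expression.\<close>

lemma ex_expression:
  assumes "x \<in> subalgebra scale u hull V"
  shows "\<exists>m \<alpha> h v. is_expression scale u V x m \<alpha> h v"
proof -
  let ?L = "{ws. set ws \<subseteq> V \<and> (u = None \<longrightarrow> ws \<noteq> [])}"
  from assms have "x \<in> span (word_prod u ` ?L)"
    using hull_subset_span_words by blast
  then obtain t a where t: "finite t" "t \<subseteq> word_prod u ` ?L" "x = (\<Sum>b\<in>t. scale (a b) b)"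
    unfolding span_explicit by blast
  obtain f where f: "bij_betw f {1..card t} t"
    using ex_bij_betw_nat_finite_1[OF t(1)] by blast
  have "\<forall>b\<in>t. \<exists>ws. ws \<in> ?L \<and> b = word_prod u ws" using t(2) by blast
  then obtain ws where ws: "\<And>b. b \<in> t \<Longrightarrow> ws b \<in> ?L" "\<And>b. b \<in> t \<Longrightarrow> b = word_prod u (ws b)"
    by metis
  define h where "h i = length (ws (f i))" for i
  \<comment> \<open>Factors are numbered from 1, list positions from 0.\<close>
  define v where "v i j = ws (f i) ! (j - 1)" for i j
  have ft: "f i \<in> t" if "i \<in> {1..card t}" for i
    using f that by (auto simp: bij_betw_def)
  have words: "map (v i) [1..<Suc (h i)] = ws (f i)" for i
    by (rule nth_equalityI) (simp_all add: h_def v_def del: upt_Suc)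
  have "x = (\<Sum>i\<in>{1..card t}. scale (a (f i)) (f i))"
    unfolding t(3) by (rule sum.reindex_bij_betw[OF f, symmetric])
  also have "\<dots> = (\<Sum>i\<in>{1..card t}. scale (a (f i)) (word_prod u (map (v i) [1..<Suc (h i)])))"
    unfolding words using ws(2)[OF ft] by (intro sum.cong) auto
  finally have "x = \<dots>" .
  moreover have "(u = None \<longrightarrow> h i \<ge> 1) \<and> (\<forall>j\<in>{1..h i}. v i j \<in> V)" if "i \<in> {1..card t}" for i
  proof -
    have "set (ws (f i)) \<subseteq> V" "u = None \<longrightarrow> ws (f i) \<noteq> []"
      using ws(1)[OF ft[OF that]] by auto
    moreover have "v i j \<in> set (ws (f i))" if "j \<in> {1..h i}" for j
      unfolding v_def using that by (intro nth_mem) (auto simp: h_def)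
    ultimately show ?thesis by (auto simp: h_def Suc_le_eq)
  qed
  ultimately have "is_expression scale u V x (card t) (\<lambda>i. a (f i)) h v"
    unfolding is_expression_def by simp
  then show ?thesis by (intro exI)
qed

section \<open>The derived polynomial on \<open>V\<close>\<close>

lemma eval_derived_poly:
  assumes "admissible u c" "vars c \<subseteq> I"
    and "\<And>p. p \<in> I \<Longrightarrow> is_expression scale u V (r p) (m p) (\<alpha> p) (h p) (v p)"
  shows "eval scale u w (derived_poly c m \<alpha> h) =
    eval scale u (\<lambda>p. eval scale u w (expression_poly (m p) (\<alpha> p) (h p) (\<lambda>i j. (p, i, j)))) c"
  unfolding derived_poly_def using assms
  \<comment> \<open>The expressions enter through the admissibility of the substituted polynomials,
    while \<open>w\<close> stays arbitrary.\<close>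
  by (intro eval_subst) (auto intro: admissible_expression_poly)

lemma ex_derived_poly_nonzero:
  assumes "admissible u c" "vars c \<subseteq> I" "0 \<in> V"
    and expr: "\<And>p. p \<in> I \<Longrightarrow> is_expression scale u V (r p) (m p) (\<alpha> p) (h p) (v p)"
    and nz: "eval scale u r c \<noteq> 0"
  shows "\<exists>w. (\<forall>y. w y \<in> V) \<and> eval scale u w (derived_poly c m \<alpha> h) \<noteq> 0"
proof -
  \<comment> \<open>Each variable goes back to the factor it replaced. Triples naming no factor get
    the default 0, which lies in \<open>V\<close>.\<close>
  define w where
    "w = (\<lambda>(p, i, j). if p \<in> I \<and> i \<in> {1..m p} \<and> j \<in> {1..h p i} then v p i j else 0)"
  have "w y \<in> V" for y
    using expr \<open>0 \<in> V\<close> by (cases y) (auto simp: w_def is_expression_def)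
  moreover have "eval scale u w (derived_poly c m \<alpha> h) = eval scale u r c"
  \<comment> \<open>The inner values equal \<open>r p\<close> for \<open>p\<close> in
    \<open>I\<close>; as \<open>I\<close> contains the variables of \<open>c\<close>,
    \<open>eval_cong\<close> is enough.\<close>
  proof (subst eval_derived_poly[OF assms(1,2) expr], assumption, rule eval_cong)
    fix p
    assume "p \<in> vars c"
    then have "p \<in> I" using assms(2) by blast
    then show "eval scale u w (expression_poly (m p) (\<alpha> p) (h p) (\<lambda>i j. (p, i, j))) = r p"
      by (intro eval_expression_poly[OF expr]) (auto simp: w_def)
  qed
  ultimately show ?thesis using nz by (intro exI[of _ w]) simp
qed

lemma central_derived_poly:
  assumes c: "central_polynomial scale u UNIV c" and "vars c \<subseteq> I" "0 \<in> V"
    and expr: "\<And>p. p \<in> I \<Longrightarrow> is_expression scale u V (r p) (m p) (\<alpha> p) (h p) (v p)"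
    and "eval scale u r c \<noteq> 0"
  shows "central_polynomial scale u V (derived_poly c m \<alpha> h)"
proof -
  have adm: "admissible u c" and cen: "\<And>s. eval scale u s c \<in> center"
    using c by (auto simp: central_polynomial_def)
  have "admissible u (derived_poly c m \<alpha> h)"
    unfolding derived_poly_def using adm assms(2) expr
    by (intro admissible_subst) (auto intro: admissible_expression_poly)
  then show ?thesis
    \<comment> \<open>Each value of the derived polynomial is a value of \<open>c\<close> on the
      whole algebra, hence central; the assignment with non-zero value rules out an
      identity.\<close>
    using ex_derived_poly_nonzero[OF adm assms(2,3) expr assms(5)] cen
      eval_derived_poly[OF adm assms(2) expr]
    unfolding central_polynomial_def pair_identity_def by auto
qed

end

theorem mainTheorem2:
  fixes scale :: "'f::field \<Rightarrow> 'a::ring \<Rightarrow> 'a"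
    and u :: "'a option"
    and V :: "'a set"
    and n :: nat
    and c :: "(nat, 'f) ncpoly"
  assumes "assoc_algebra scale u"
    and "(center :: 'a set) \<noteq> {0}"
    and "module.subspace scale V"
    and "subalgebra scale u hull V = UNIV"
    and "vars c \<subseteq> {1..n}"
    and "central_polynomial scale u UNIV c"
    and "\<not> multilinear {1..n} c"
  shows "(\<exists>r. eval scale u r c \<noteq> 0) \<and>
    (\<forall>r. eval scale u r c \<noteq> 0 \<longrightarrow>
      (\<forall>p\<in>{1..n}. \<exists>m \<alpha> h v. is_expression scale u V (r p) m \<alpha> h v) \<and>
      (\<forall>m \<alpha> h v.
        (\<forall>p\<in>{1..n}. is_expression scale u V (r p) (m p) (\<alpha> p) (h p) (v p)) \<longrightarrow>
        (\<exists>w. (\<forall>y. w y \<in> V) \<and> eval scale u w (derived_poly c m \<alpha> h) \<noteq> 0) \<and>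
        central_polynomial scale u V (derived_poly c m \<alpha> h)))"
proof -
  interpret assoc_algebra scale u by fact
  have zero: "0 \<in> V" using assms(3) by (rule subspace_0)
  have adm: "admissible u c" using assms(6) by (simp add: central_polynomial_def)
  have "\<exists>r. eval scale u r c \<noteq> 0"
    using assms(6) by (auto simp: central_polynomial_def pair_identity_def)
  moreover have "\<exists>m \<alpha> h v. is_expression scale u V x m \<alpha> h v" for x
    by (rule ex_expression) (simp add: assms(4))
  moreover have "(\<exists>w. (\<forall>y. w y \<in> V) \<and> eval scale u w (derived_poly c m \<alpha> h) \<noteq> 0) \<and>
      central_polynomial scale u V (derived_poly c m \<alpha> h)"
    if "eval scale u r c \<noteq> 0"
      and "\<forall>p\<in>{1..n}. is_expression scale u V (r p) (m p) (\<alpha> p) (h p) (v p)" for r m \<alpha> h v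
    using ex_derived_poly_nonzero[OF adm assms(5) zero, of r m \<alpha> h v]
      central_derived_poly[OF assms(6,5) zero, of r m \<alpha> h v] that by blast
  ultimately show ?thesis by blast
qed

end
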